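(* Let $(P,\cdot,\circ)$ be a transposed Novikov-Poisson algebra over a field $\mathbf{k}$ with $\operatorname{char}\mathbf{k}\neq 2$. Then the following statements are equivalent: (a) $P$ is metatrivial; (b) $P$ is a solvable algebra with $(c_1*_1c_2)*_2(c_3*_3c_4)=0$ for all $c_1,c_2,c_3,c_4\in P$ and all $*_1,*_2,*_3\in\{\cdot,\circ\}$; (c) the derived algebra $P^2=P\cdot P+P\circ P$ is an abelian subalgebra of $P$.
   Context: A (left) Novikov algebra $(P,\circ)$ is a vector space with a bilinear operation satisfying $(x\circ y)\circ z=(x\circ z)\circ y$ and $(x\circ y)\circ z-x\circ(y\circ z)=(y\circ x)\circ z-y\circ(x\circ z)$ for all $x,y,z$. A transposed Novikov-Poisson algebra is a triple $(P,\cdot,\circ)$ such that $(P,\cdot)$ is a commutative associative algebra (not necessarily unital), $(P,\circ)$ is a Novikov algebra, and for all $x,y,z\in P$: $(x\cdot y)\circ z=(x\cdot z)\circ y$ and $2z\cdot(x\circ y)=(z\cdot x)\circ y+x\circ(z\cdot y)$. For subspaces $X,Y$ of $P$, $X\cdot Y$ (resp. $X\circ Y$) denotes the linear span of all $x\cdot y$ (resp. $x\circ y$), $x\in X$, $y\in Y$. A subalgebra is a linear subspace $A$ with $A\cdot A+A\circ A\subseteq A$. $P$ is solvable if $P^{(m)}=0$ for some $m\ge 0$, where $P^{(0)}=P$ and $P^{(n+1)}=P^{(n)}\cdot P^{(n)}+P^{(n)}\circ P^{(n)}$. An algebra with two products $\cdot,\circ$ is abelian if $a\cdot b=a\circ b=0$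 for all elements $a,b$. $P$ is metatrivial if there exist abelian transposed Novikov-Poisson algebras $V_1,V_2$ and an exact sequence of algebra morphisms (linear maps preserving both products) $0\to V_1\xrightarrow{i}P\xrightarrow{\pi}V_2\to 0$. *)

theory Defs
  imports "HOL-Algebra.AbelCoset" "HOL-Algebra.Module" "HOL-Algebra.Multiplicative_Group" "HOL.Hull"
begin

text \<open>
  A vector space with two bilinear products over a field \<open>k\<close>: the product written \<open>\<cdot>\<close> in the
  literature is the \<open>mult\<close> field (\<open>\<otimes>\<close>), the product written \<open>\<circ>\<close> is \<open>circ\<close> (\<open>\<star>\<close>).
  As in the library's own use of the \<open>module\<close> record, the inherited field \<open>one\<close> of such a record
  is never constrained and carries no meaning, so algebras need not be unital.
\<close>

record ('k, 'p) bialg = "('k, 'p) module" +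
  circ :: "'p \<Rightarrow> 'p \<Rightarrow> 'p" (infixl \<open>\<star>\<index>\<close> 70)

definition bilinear_op ::
    "('k, 'r) ring_scheme \<Rightarrow> ('k, 'p) bialg \<Rightarrow> ('p \<Rightarrow> 'p \<Rightarrow> 'p) \<Rightarrow> bool" where
  "bilinear_op k P f \<longleftrightarrow>
     (\<forall>x\<in>carrier P. \<forall>y\<in>carrier P. f x y \<in> carrier P) \<and>
     (\<forall>x\<in>carrier P. \<forall>y\<in>carrier P. \<forall>z\<in>carrier P.
        f (x \<oplus>\<^bsub>P\<^esub> y) z = f x z \<oplus>\<^bsub>P\<^esub> f y z \<and> f x (y \<oplus>\<^bsub>P\<^esub> z) = f x y \<oplus>\<^bsub>P\<^esub> f x z) \<and>
     (\<forall>a\<in>carrier k. \<forall>x\<in>carrier P. \<forall>y\<in>carrier P.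
        f (a \<odot>\<^bsub>P\<^esub> x) y = a \<odot>\<^bsub>P\<^esub> f x y \<and> f x (a \<odot>\<^bsub>P\<^esub> y) = a \<odot>\<^bsub>P\<^esub> f x y)"

locale transposed_novikov_poisson = field k + module k P
  for k :: "('k, 'r) ring_scheme" and P :: "('k, 'p) bialg" +
  assumes mult_bilinear: "bilinear_op k P (monoid.mult P)"
    and circ_bilinear: "bilinear_op k P (circ P)"
    and mult_assoc: "\<lbrakk>x \<in> carrier P; y \<in> carrier P; z \<in> carrier P\<rbrakk> \<Longrightarrow>
      (x \<otimes>\<^bsub>P\<^esub> y) \<otimes>\<^bsub>P\<^esub> z = x \<otimes>\<^bsub>P\<^esub> (y \<otimes>\<^bsub>P\<^esub> z)"
    and mult_comm: "\<lbrakk>x \<in> carrier P; y \<in> carrier P\<rbrakk> \<Longrightarrow> x \<otimes>\<^bsub>P\<^esub> y = y \<otimes>\<^bsub>P\<^esub> x"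
    and circ_right_comm: "\<lbrakk>x \<in> carrier P; y \<in> carrier P; z \<in> carrier P\<rbrakk> \<Longrightarrow>
      (x \<star>\<^bsub>P\<^esub> y) \<star>\<^bsub>P\<^esub> z = (x \<star>\<^bsub>P\<^esub> z) \<star>\<^bsub>P\<^esub> y"
    and circ_left_symmetric: "\<lbrakk>x \<in> carrier P; y \<in> carrier P; z \<in> carrier P\<rbrakk> \<Longrightarrow>
      ((x \<star>\<^bsub>P\<^esub> y) \<star>\<^bsub>P\<^esub> z) \<ominus>\<^bsub>P\<^esub> (x \<star>\<^bsub>P\<^esub> (y \<star>\<^bsub>P\<^esub> z)) =
      ((y \<star>\<^bsub>P\<^esub> x) \<star>\<^bsub>P\<^esub> z) \<ominus>\<^bsub>P\<^esub> (y \<star>\<^bsub>P\<^esub> (x \<star>\<^bsub>P\<^esub> z))"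
    and mult_circ_comm: "\<lbrakk>x \<in> carrier P; y \<in> carrier P; z \<in> carrier P\<rbrakk> \<Longrightarrow>
      (x \<otimes>\<^bsub>P\<^esub> y) \<star>\<^bsub>P\<^esub> z = (x \<otimes>\<^bsub>P\<^esub> z) \<star>\<^bsub>P\<^esub> y"
    and transposed_leibniz: "\<lbrakk>x \<in> carrier P; y \<in> carrier P; z \<in> carrier P\<rbrakk> \<Longrightarrow>
      [(2::nat)] \<cdot>\<^bsub>P\<^esub> (z \<otimes>\<^bsub>P\<^esub> (x \<star>\<^bsub>P\<^esub> y)) =
      ((z \<otimes>\<^bsub>P\<^esub> x) \<star>\<^bsub>P\<^esub> y) \<oplus>\<^bsub>P\<^esub> (x \<star>\<^bsub>P\<^esub> (z \<otimes>\<^bsub>P\<^esub> y))"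

text \<open>The characteristic is the additive order of \<open>1\<close>; \<open>group.ord\<close> is \<open>0\<close> for infinite order.\<close>

definition ring_char :: "('k, 'r) ring_scheme \<Rightarrow> nat" where
  "ring_char k = group.ord (add_monoid k) \<one>\<^bsub>k\<^esub>"

definition lin_span :: "('k, 'r) ring_scheme \<Rightarrow> ('k, 'p) bialg \<Rightarrow> 'p set \<Rightarrow> 'p set" where
  "lin_span k P S = (\<lambda>N. submodule N k P) hull S"

definition span_prod ::
    "('k, 'r) ring_scheme \<Rightarrow> ('k, 'p) bialg \<Rightarrow> ('p \<Rightarrow> 'p \<Rightarrow> 'p) \<Rightarrow> 'p set \<Rightarrow> 'p set \<Rightarrow> 'p set" where
  "span_prod k P f A B = lin_span k P {f x y | x y. x \<in> A \<and> y \<in> B}"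

definition derived_bialg :: "('k, 'r) ring_scheme \<Rightarrow> ('k, 'p) bialg \<Rightarrow> 'p set \<Rightarrow> 'p set" where
  "derived_bialg k P A = span_prod k P (monoid.mult P) A A <+>\<^bsub>P\<^esub> span_prod k P (circ P) A A"

definition derived_series_bialg :: "('k, 'r) ring_scheme \<Rightarrow> ('k, 'p) bialg \<Rightarrow> nat \<Rightarrow> 'p set" where
  "derived_series_bialg k P n = (derived_bialg k P ^^ n) (carrier P)"

definition solvable_bialg :: "('k, 'r) ring_scheme \<Rightarrow> ('k, 'p) bialg \<Rightarrow> bool" where
  "solvable_bialg k P \<longleftrightarrow> (\<exists>m. derived_series_bialg k P m = {\<zero>\<^bsub>P\<^esub>})"

definition subalgebra_bialg :: "('k, 'r) ring_scheme \<Rightarrow> ('k, 'p) bialg \<Rightarrow> 'p set \<Rightarrow> bool" where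
  "subalgebra_bialg k P A \<longleftrightarrow> submodule A k P \<and> derived_bialg k P A \<subseteq> A"

definition abelian_on :: "('k, 'p) bialg \<Rightarrow> 'p set \<Rightarrow> bool" where
  "abelian_on P A \<longleftrightarrow> (\<forall>a\<in>A. \<forall>b\<in>A. a \<otimes>\<^bsub>P\<^esub> b = \<zero>\<^bsub>P\<^esub> \<and> a \<star>\<^bsub>P\<^esub> b = \<zero>\<^bsub>P\<^esub>)"

definition abelian_tnp :: "('k, 'r) ring_scheme \<Rightarrow> ('k, 'p) bialg \<Rightarrow> bool" where
  "abelian_tnp k V \<longleftrightarrow> transposed_novikov_poisson k V \<and> abelian_on V (carrier V)"

definition bialg_hom ::
    "('k, 'r) ring_scheme \<Rightarrow> ('k, 'v) bialg \<Rightarrow> ('k, 'w) bialg \<Rightarrow> ('v \<Rightarrow> 'w) set" where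
  "bialg_hom k V W = {f. f \<in> carrier V \<rightarrow> carrier W \<and>
     (\<forall>x\<in>carrier V. \<forall>y\<in>carrier V. f (x \<oplus>\<^bsub>V\<^esub> y) = f x \<oplus>\<^bsub>W\<^esub> f y) \<and>
     (\<forall>a\<in>carrier k. \<forall>x\<in>carrier V. f (a \<odot>\<^bsub>V\<^esub> x) = a \<odot>\<^bsub>W\<^esub> f x) \<and>
     (\<forall>x\<in>carrier V. \<forall>y\<in>carrier V. f (x \<otimes>\<^bsub>V\<^esub> y) = f x \<otimes>\<^bsub>W\<^esub> f y) \<and>
     (\<forall>x\<in>carrier V. \<forall>y\<in>carrier V. f (x \<star>\<^bsub>V\<^esub> y) = f x \<star>\<^bsub>W\<^esub> f y)}"

definition short_exact ::
    "('k, 'r) ring_scheme \<Rightarrow> ('k, 'v) bialg \<Rightarrow> ('v \<Rightarrow> 'p) \<Rightarrow> ('k, 'p) bialg \<Rightarrow> ('p \<Rightarrow> 'w) \<Rightarrow>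
     ('k, 'w) bialg \<Rightarrow> bool" where
  "short_exact k V1 i P p V2 \<longleftrightarrow>
     i \<in> bialg_hom k V1 P \<and> p \<in> bialg_hom k P V2 \<and>
     a_kernel V1 P i = {\<zero>\<^bsub>V1\<^esub>} \<and>
     i ` carrier V1 = a_kernel P V2 p \<and>
     p ` carrier P = carrier V2"

text \<open>
  HOL cannot quantify over the types underlying \<open>V1\<close> and \<open>V2\<close>. Up to isomorphism \<open>V1\<close> is a
  subspace of \<open>P\<close> and \<open>V2\<close> a set of cosets in \<open>P\<close>, so the types \<open>'p\<close> and \<open>'p set\<close> are general
  enough; \<open>metatrivialI\<close> below shows that witnesses over arbitrary types suffice.
\<close>

definition metatrivial :: "('k, 'r) ring_scheme \<Rightarrow> ('k, 'p) bialg \<Rightarrow> bool" where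
  "metatrivial k P \<longleftrightarrow>
     (\<exists>(V1 :: ('k, 'p) bialg) (V2 :: ('k, 'p set) bialg) i p.
        abelian_tnp k V1 \<and> abelian_tnp k V2 \<and> short_exact k V1 i P p V2)"

definition transport :: "('k, 'v) bialg \<Rightarrow> ('v \<Rightarrow> 'w) \<Rightarrow> ('k, 'w) bialg" where
  "transport V f = (let g = the_inv_into (carrier V) f in
     \<lparr>carrier = f ` carrier V,
      mult = (\<lambda>x y. f (g x \<otimes>\<^bsub>V\<^esub> g y)), one = f \<one>\<^bsub>V\<^esub>,
      zero = f \<zero>\<^bsub>V\<^esub>, add = (\<lambda>x y. f (g x \<oplus>\<^bsub>V\<^esub> g y)),
      smult = (\<lambda>a x. f (a \<odot>\<^bsub>V\<^esub> g x)),
      circ = (\<lambda>x y. f (g x \<star>\<^bsub>V\<^esub> g y))\<rparr>)"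

lemma transport_simps:
  assumes "inj_on f (carrier V)"
  shows "carrier (transport V f) = f ` carrier V"
    and "\<zero>\<^bsub>transport V f\<^esub> = f \<zero>\<^bsub>V\<^esub>"
    and "\<lbrakk>x \<in> carrier V; y \<in> carrier V\<rbrakk> \<Longrightarrow> f x \<oplus>\<^bsub>transport V f\<^esub> f y = f (x \<oplus>\<^bsub>V\<^esub> y)"
    and "\<lbrakk>x \<in> carrier V; y \<in> carrier V\<rbrakk> \<Longrightarrow> f x \<otimes>\<^bsub>transport V f\<^esub> f y = f (x \<otimes>\<^bsub>V\<^esub> y)"
    and "\<lbrakk>x \<in> carrier V; y \<in> carrier V\<rbrakk> \<Longrightarrow> f x \<star>\<^bsub>transport V f\<^esub> f y = f (x \<star>\<^bsub>V\<^esub> y)"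
    and "x \<in> carrier V \<Longrightarrow> a \<odot>\<^bsub>transport V f\<^esub> f x = f (a \<odot>\<^bsub>V\<^esub> x)"
  by (simp_all add: transport_def Let_def the_inv_into_f_f[OF assms])

lemma transport_tnp:
  assumes V: "transposed_novikov_poisson k V" and inj: "inj_on f (carrier V)"
  shows "transposed_novikov_poisson k (transport V f)"
proof -
  interpret V: transposed_novikov_poisson k V by (rule V)
  note ts = transport_simps[OF inj]
  let ?T = "transport V f"
  have closed: "x \<otimes>\<^bsub>V\<^esub> y \<in> carrier V" "x \<star>\<^bsub>V\<^esub> y \<in> carrier V"
    if "x \<in> carrier V" "y \<in> carrier V" for x y
    using that V.mult_bilinear V.circ_bilinear by (auto simp: bilinear_op_def)
  have ab: "abelian_group ?T"
  proof (rule abelian_groupI)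
    fix x assume "x \<in> carrier ?T"
    then obtain u where u: "u \<in> carrier V" "x = f u" by (auto simp: ts)
    then show "\<exists>y\<in>carrier ?T. y \<oplus>\<^bsub>?T\<^esub> x = \<zero>\<^bsub>?T\<^esub>"
      by (intro bexI[of _ "f (\<ominus>\<^bsub>V\<^esub> u)"]) (auto simp: ts V.M.l_neg)
  qed (auto simp: ts V.M.a_ac)
  have md: "module k ?T"
    by (rule moduleI[OF module.axioms(1)[OF V.module_axioms] ab])
      (auto simp: ts V.smult_l_distr V.smult_r_distr V.smult_assoc1)
  interpret T: module k ?T by (rule md)
  have neg: "\<ominus>\<^bsub>?T\<^esub> f x = f (\<ominus>\<^bsub>V\<^esub> x)" if "x \<in> carrier V" for x
    using that by (intro T.M.minus_equality) (auto simp: ts V.M.l_neg)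
  have sub: "f x \<ominus>\<^bsub>?T\<^esub> f y = f (x \<ominus>\<^bsub>V\<^esub> y)" if "x \<in> carrier V" "y \<in> carrier V" for x y
    using that by (simp add: a_minus_def neg ts)
  have two: "[(2::nat)] \<cdot>\<^bsub>?T\<^esub> f x = f ([(2::nat)] \<cdot>\<^bsub>V\<^esub> x)" if "x \<in> carrier V" for x
    using that by (simp add: numeral_2_eq_2 add_pow_def ts nat_pow_def)
  show ?thesis
  proof (intro transposed_novikov_poisson.intro transposed_novikov_poisson_axioms.intro)
    show "field k" by (rule V.field_axioms)
    show "module k ?T" by (rule md)
    show "bilinear_op k ?T (monoid.mult ?T)"
      using V.mult_bilinear by (auto simp: bilinear_op_def ts closed)
    show "bilinear_op k ?T (circ ?T)"
      using V.circ_bilinear by (auto simp: bilinear_op_def ts closed)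
  next
    fix x y z assume "x \<in> carrier ?T" "y \<in> carrier ?T" "z \<in> carrier ?T"
    then obtain u v w where *: "u \<in> carrier V" "v \<in> carrier V" "w \<in> carrier V"
      "x = f u" "y = f v" "z = f w" by (auto simp: ts)
    show "(x \<otimes>\<^bsub>?T\<^esub> y) \<otimes>\<^bsub>?T\<^esub> z = x \<otimes>\<^bsub>?T\<^esub> (y \<otimes>\<^bsub>?T\<^esub> z)"
      using * by (simp add: ts closed V.mult_assoc)
    show "(x \<star>\<^bsub>?T\<^esub> y) \<star>\<^bsub>?T\<^esub> z = (x \<star>\<^bsub>?T\<^esub> z) \<star>\<^bsub>?T\<^esub> y"
      using * V.circ_right_comm[of u v w] by (simp add: ts closed)
    show "((x \<star>\<^bsub>?T\<^esub> y) \<star>\<^bsub>?T\<^esub> z) \<ominus>\<^bsub>?T\<^esub> (x \<star>\<^bsub>?T\<^esub> (y \<star>\<^bsub>?T\<^esub> z)) =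
      ((y \<star>\<^bsub>?T\<^esub> x) \<star>\<^bsub>?T\<^esub> z) \<ominus>\<^bsub>?T\<^esub> (y \<star>\<^bsub>?T\<^esub> (x \<star>\<^bsub>?T\<^esub> z))"
      using * V.circ_left_symmetric[of u v w] by (simp add: ts closed sub)
    show "(x \<otimes>\<^bsub>?T\<^esub> y) \<star>\<^bsub>?T\<^esub> z = (x \<otimes>\<^bsub>?T\<^esub> z) \<star>\<^bsub>?T\<^esub> y"
      using * V.mult_circ_comm[of u v w] by (simp add: ts closed)
    show "[(2::nat)] \<cdot>\<^bsub>?T\<^esub> (z \<otimes>\<^bsub>?T\<^esub> (x \<star>\<^bsub>?T\<^esub> y)) =
      ((z \<otimes>\<^bsub>?T\<^esub> x) \<star>\<^bsub>?T\<^esub> y) \<oplus>\<^bsub>?T\<^esub> (x \<star>\<^bsub>?T\<^esub> (z \<otimes>\<^bsub>?T\<^esub> y))"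
      using * V.transposed_leibniz[of u v w] by (simp add: ts closed two)
  next
    fix x y assume "x \<in> carrier ?T" "y \<in> carrier ?T"
    then obtain u v where *: "u \<in> carrier V" "v \<in> carrier V" "x = f u" "y = f v"
      by (auto simp: ts)
    show "x \<otimes>\<^bsub>?T\<^esub> y = y \<otimes>\<^bsub>?T\<^esub> x"
      using * V.mult_comm[of u v] by (simp add: ts closed)
  qed
qed

lemma transport_abelian_tnp:
  assumes "abelian_tnp k V" "inj_on f (carrier V)"
  shows "abelian_tnp k (transport V f)"
  using assms transport_tnp[of k V f]
  by (auto simp: abelian_tnp_def abelian_on_def transport_simps[OF assms(2)])

lemma metatrivialI:
  fixes V1 :: "('k, 'v) bialg" and V2 :: "('k, 'w) bialg" and P :: "('k, 'p) bialg"
  assumes P: "transposed_novikov_poisson k P"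
    and V1: "abelian_tnp k V1" and V2: "abelian_tnp k V2"
    and ex: "short_exact k V1 i P p V2"
  shows "metatrivial k P"
proof -
  interpret P: transposed_novikov_poisson k P by (rule P)
  interpret V1: transposed_novikov_poisson k V1 using V1 by (simp add: abelian_tnp_def)
  interpret V2: transposed_novikov_poisson k V2 using V2 by (simp add: abelian_tnp_def)
  have i: "i \<in> bialg_hom k V1 P" and p: "p \<in> bialg_hom k P V2"
    and ker: "a_kernel V1 P i = {\<zero>\<^bsub>V1\<^esub>}"
    and mid: "i ` carrier V1 = a_kernel P V2 p" and sur: "p ` carrier P = carrier V2"
    using ex by (auto simp: short_exact_def)
  have "group_hom (add_monoid V1) (add_monoid P) i"
    using i by (auto simp: group_hom_def group_hom_axioms_def V1.M.a_group P.M.a_group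
      bialg_hom_def hom_def)
  then have i_inj: "inj_on i (carrier V1)"
    using ker group_hom.inj_iff_trivial_ker unfolding a_kernel_def by fastforce
  have i0: "i \<zero>\<^bsub>V1\<^esub> = \<zero>\<^bsub>P\<^esub>"
    using ker by (auto simp: a_kernel_def')
  define q where "q w = {x \<in> carrier P. p x = w}" for w
  have q_inj: "inj_on q (carrier V2)"
  proof (rule inj_onI)
    fix w w' assume "w \<in> carrier V2" "w' \<in> carrier V2" "q w = q w'"
    moreover from \<open>w \<in> carrier V2\<close> obtain x where "x \<in> carrier P" "p x = w"
      using sur by (metis imageE)
    ultimately show "w = w'" by (auto simp: q_def)
  qed
  note t1 = transport_simps[OF i_inj] and t2 = transport_simps[OF q_inj]
  let ?V1 = "transport V1 i" and ?V2 = "transport V2 q"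
  have pc: "p x \<in> carrier V2" if "x \<in> carrier P" for x using sur that by auto
  have "id \<in> bialg_hom k ?V1 P"
    using i by (auto simp: bialg_hom_def t1)
  moreover have "q \<circ> p \<in> bialg_hom k P ?V2"
    using p by (auto simp: bialg_hom_def t2 pc)
  moreover have "a_kernel ?V1 P id = {\<zero>\<^bsub>?V1\<^esub>}"
    using i0 image_eqI[of "\<zero>\<^bsub>P\<^esub>" i "\<zero>\<^bsub>V1\<^esub>" "carrier V1"]
    by (auto simp: a_kernel_def' t1)
  moreover have "id ` carrier ?V1 = a_kernel P ?V2 (q \<circ> p)"
    using q_inj pc mid by (auto simp: a_kernel_def' t1 t2 inj_on_def)
  moreover have "(q \<circ> p) ` carrier P = carrier ?V2"
    unfolding t2(1) image_comp[symmetric] sur ..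
  ultimately have "short_exact k ?V1 id P (q \<circ> p) ?V2"
    by (simp add: short_exact_def)
  then show ?thesis
    unfolding metatrivial_def
    using transport_abelian_tnp[OF V1 i_inj] transport_abelian_tnp[OF V2 q_inj] by blast
qed

end

theory Submission
  imports Defs
begin

text \<open>
  The image of the ideal \<open>V\<^sub>1\<close> in a metatrivial \<open>P\<close> contains every product, because the quotient
  \<open>V\<^sub>2\<close> is abelian; hence it contains \<open>P\<^sup>2\<close>, which inherits abelianness from \<open>V\<^sub>1\<close>. Conversely, an
  abelian \<open>P\<^sup>2\<close> gives the extension \<open>0 \<rightarrow> P\<^sup>2 \<rightarrow> P \<rightarrow> P/P\<^sup>2 \<rightarrow> 0\<close>. By bilinearity, \<open>P\<^sup>2\<close> is abelian as
  soon as all products of two products vanish.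
\<close>

section \<open>Submodules: a closure criterion, intersections and sums\<close>

context module
begin

lemma a_inv_eq_smult:
  assumes "x \<in> carrier M"
  shows "\<ominus>\<^bsub>M\<^esub> x = (\<ominus> \<one>) \<odot>\<^bsub>M\<^esub> x"
proof (rule M.minus_equality)
  have "(\<ominus> \<one>) \<odot>\<^bsub>M\<^esub> x \<oplus>\<^bsub>M\<^esub> x = (\<ominus> \<one> \<oplus> \<one>) \<odot>\<^bsub>M\<^esub> x"
    using assms by (subst smult_l_distr) auto
  then show "(\<ominus> \<one>) \<odot>\<^bsub>M\<^esub> x \<oplus>\<^bsub>M\<^esub> x = \<zero>\<^bsub>M\<^esub>" using assms by (simp add: R.l_neg)
qed (use assms in auto)

text \<open>Negation is scaling by -1, so closure under scalars already yields closure under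
  additive inverses.\<close>

lemma submoduleI_smult:
  assumes "H \<subseteq> carrier M" "\<zero>\<^bsub>M\<^esub> \<in> H"
    and "\<And>x y. \<lbrakk>x \<in> H; y \<in> H\<rbrakk> \<Longrightarrow> x \<oplus>\<^bsub>M\<^esub> y \<in> H"
    and "\<And>a x. \<lbrakk>a \<in> carrier R; x \<in> H\<rbrakk> \<Longrightarrow> a \<odot>\<^bsub>M\<^esub> x \<in> H"
  shows "submodule H R M"
  using assms by (intro submoduleI) (auto simp: a_inv_eq_smult subset_iff)

lemma zero_mem_submodule: "submodule N R M \<Longrightarrow> \<zero>\<^bsub>M\<^esub> \<in> N"
  using subgroup.one_closed[OF submodule.axioms(1)] by fastforce

text \<open>For showing that linear spans, which are hulls, are submodules. Nonemptiness of the
  family matters: the empty intersection is the whole type and may leave the carrier.\<close>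

lemma submodule_Inter:
  assumes "\<F> \<noteq> {}" "\<And>N. N \<in> \<F> \<Longrightarrow> submodule N R M"
  shows "submodule (\<Inter>\<F>) R M"
proof (rule submoduleI_smult)
  show "\<Inter>\<F> \<subseteq> carrier M" using assms submoduleE(1) by blast
qed (use assms zero_mem_submodule submoduleE(4,5) in blast)+

lemma submodule_set_add:
  assumes A: "submodule A R M" and B: "submodule B R M"
  shows "submodule (A <+>\<^bsub>M\<^esub> B) R M"
proof (rule submoduleI_smult)
  note sub = subsetD[OF submoduleE(1)[OF A]] subsetD[OF submoduleE(1)[OF B]]
  show "A <+>\<^bsub>M\<^esub> B \<subseteq> carrier M" using sub by (auto simp: set_add_def')
  show "\<zero>\<^bsub>M\<^esub> \<in> A <+>\<^bsub>M\<^esub> B"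
    using zero_mem_submodule[OF A] zero_mem_submodule[OF B] by (force simp: set_add_def')
  fix x y assume "x \<in> A <+>\<^bsub>M\<^esub> B" "y \<in> A <+>\<^bsub>M\<^esub> B"
  then obtain a b c d where *: "a \<in> A" "b \<in> B" "c \<in> A" "d \<in> B"
      "x = a \<oplus>\<^bsub>M\<^esub> b" "y = c \<oplus>\<^bsub>M\<^esub> d"
    by (auto simp: set_add_def')
  then have "x \<oplus>\<^bsub>M\<^esub> y = (a \<oplus>\<^bsub>M\<^esub> c) \<oplus>\<^bsub>M\<^esub> (b \<oplus>\<^bsub>M\<^esub> d)" by (simp add: sub M.a_ac)
  then show "x \<oplus>\<^bsub>M\<^esub> y \<in> A <+>\<^bsub>M\<^esub> B"
    using * submoduleE(5)[OF A, of a c] submoduleE(5)[OF B, of b d] unfolding set_add_def' by blast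
next
  note sub = subsetD[OF submoduleE(1)[OF A]] subsetD[OF submoduleE(1)[OF B]]
  fix r x assume r: "r \<in> carrier R" and "x \<in> A <+>\<^bsub>M\<^esub> B"
  then obtain a b where *: "a \<in> A" "b \<in> B" "x = a \<oplus>\<^bsub>M\<^esub> b" by (auto simp: set_add_def')
  then have "r \<odot>\<^bsub>M\<^esub> x = r \<odot>\<^bsub>M\<^esub> a \<oplus>\<^bsub>M\<^esub> r \<odot>\<^bsub>M\<^esub> b" using r by (simp add: sub smult_r_distr)
  then show "r \<odot>\<^bsub>M\<^esub> x \<in> A <+>\<^bsub>M\<^esub> B"
    using * r submoduleE(4)[OF A, of r a] submoduleE(4)[OF B, of r b] unfolding set_add_def' by blast
qed

lemma set_add_subset_submodule:
  assumes "submodule N R M" "A \<subseteq> N" "B \<subseteq> N"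
  shows "A <+>\<^bsub>M\<^esub> B \<subseteq> N"
  using assms submoduleE(5) by (fastforce simp: set_add_def')

lemma submodule_zero: "submodule {\<zero>\<^bsub>M\<^esub>} R M"
  by (rule submoduleI_smult) auto

end

section \<open>Spans of products, the derived algebra and annihilators\<close>

lemma submodule_lin_span:
  assumes "module k P" "S \<subseteq> carrier P"
  shows "submodule (lin_span k P S) k P"
  unfolding lin_span_def hull_def
  \<comment> \<open>The intersected family is nonempty because \<open>carrier P\<close> is a
    submodule containing \<open>S\<close>.\<close>
  using assms module.carrier_is_submodule by (intro module.submodule_Inter) auto

lemma span_prod_mono: "\<lbrakk>A \<subseteq> A'; B \<subseteq> B'\<rbrakk> \<Longrightarrow> span_prod k P f A B \<subseteq> span_prod k P f A' B'"
  unfolding span_prod_def lin_span_def by (rule hull_mono) blast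

lemma span_prod_subset:
  "\<lbrakk>submodule N k P; \<And>x y. \<lbrakk>x \<in> A; y \<in> B\<rbrakk> \<Longrightarrow> f x y \<in> N\<rbrakk> \<Longrightarrow> span_prod k P f A B \<subseteq> N"
  unfolding span_prod_def lin_span_def by (rule hull_minimal) auto

lemma span_prod_mem: "\<lbrakk>x \<in> A; y \<in> B\<rbrakk> \<Longrightarrow> f x y \<in> span_prod k P f A B"
  unfolding span_prod_def lin_span_def by (rule hull_inc) blast

lemma submodule_span_prod:
  assumes "module k P" "bilinear_op k P f" "A \<subseteq> carrier P" "B \<subseteq> carrier P"
  shows "submodule (span_prod k P f A B) k P"
  unfolding span_prod_def
  using assms by (intro submodule_lin_span) (auto simp: bilinear_op_def subset_iff)

lemma derived_bialg_mono: "A \<subseteq> B \<Longrightarrow> derived_bialg k P A \<subseteq> derived_bialg k P B"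
  unfolding derived_bialg_def set_add_def
  by (intro mono_set_mult span_prod_mono)

text \<open>Each span is the least submodule containing its products, and a submodule absorbs sums,
  so only single products need testing.\<close>

lemma derived_bialg_subset:
  assumes "module k P" "submodule N k P"
    and "\<And>x y. \<lbrakk>x \<in> A; y \<in> A\<rbrakk> \<Longrightarrow> x \<otimes>\<^bsub>P\<^esub> y \<in> N"
    and "\<And>x y. \<lbrakk>x \<in> A; y \<in> A\<rbrakk> \<Longrightarrow> x \<star>\<^bsub>P\<^esub> y \<in> N"
  shows "derived_bialg k P A \<subseteq> N"
  unfolding derived_bialg_def
  using assms by (intro module.set_add_subset_submodule span_prod_subset) auto

text \<open>Lets vanishing pass from generators to their span. \<open>T\<close> is an arbitrary
  subset, so it can be a set of generators as well as a whole submodule.\<close>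

lemma submodule_left_annihilator:
  assumes "module k P" and f: "bilinear_op k P f" and T: "T \<subseteq> carrier P"
  shows "submodule {x \<in> carrier P. \<forall>y\<in>T. f x y = \<zero>\<^bsub>P\<^esub>} k P"
proof -
  interpret module k P by fact
  \<comment> \<open>\<open>bilinear_op\<close> does not list this; it follows from homogeneity with
    the scalar zero.\<close>
  have "f \<zero>\<^bsub>P\<^esub> y = \<zero>\<^bsub>P\<^esub>" if "y \<in> carrier P" for y
  proof -
    have "f \<zero>\<^bsub>P\<^esub> y = f (\<zero>\<^bsub>k\<^esub> \<odot>\<^bsub>P\<^esub> \<zero>\<^bsub>P\<^esub>) y" by simp
    also have "\<dots> = \<zero>\<^bsub>k\<^esub> \<odot>\<^bsub>P\<^esub> f \<zero>\<^bsub>P\<^esub> y"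
      using f that unfolding bilinear_op_def by blast
    finally show ?thesis using f that by (simp add: bilinear_op_def)
  qed
  then show ?thesis
    using f T by (intro submoduleI_smult) (auto simp: bilinear_op_def subset_iff)
qed

lemma bilinear_op_flip: "bilinear_op k P f \<Longrightarrow> bilinear_op k P (\<lambda>x y. f y x)"
  by (auto simp: bilinear_op_def)

lemma submodule_right_annihilator:
  assumes "module k P" "bilinear_op k P f" "T \<subseteq> carrier P"
  shows "submodule {y \<in> carrier P. \<forall>x\<in>T. f x y = \<zero>\<^bsub>P\<^esub>} k P"
  using submodule_left_annihilator[OF assms(1) bilinear_op_flip[OF assms(2)] assms(3)] .

section \<open>Algebras with zero products and quotient spaces\<close>

lemma abelian_tnpI:
  assumes "field k" "module k V" "abelian_on V (carrier V)"
  shows "abelian_tnp k V"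
proof -
  interpret field k by fact
  interpret V: module k V by fact
  have [simp]: "x \<otimes>\<^bsub>V\<^esub> y = \<zero>\<^bsub>V\<^esub>" "x \<star>\<^bsub>V\<^esub> y = \<zero>\<^bsub>V\<^esub>" if "x \<in> carrier V" "y \<in> carrier V" for x y
    using assms(3) that by (auto simp: abelian_on_def)
  \<comment> \<open>When all products vanish, both sides of every defining identity are
    zero.\<close>
  have "transposed_novikov_poisson k V"
    by (intro transposed_novikov_poisson.intro transposed_novikov_poisson_axioms.intro assms)
      (auto simp: bilinear_op_def)
  then show ?thesis using assms by (simp add: abelian_tnp_def)
qed

text \<open>
  The quotient vector space by \<open>N\<close> with both products zero; it is the quotient algebra
  whenever \<open>N\<close> contains all products.
\<close>

definition null_quotient :: "('k, 'p) bialg \<Rightarrow> 'p set \<Rightarrow> ('k, 'p set) bialg" where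
  "null_quotient P N =
     \<lparr>carrier = a_rcosets\<^bsub>P\<^esub> N, mult = (\<lambda>_ _. N), one = N, zero = N, add = set_add P,
      smult = (\<lambda>a X. N <+>\<^bsub>P\<^esub> (\<lambda>x. a \<odot>\<^bsub>P\<^esub> x) ` X), circ = (\<lambda>_ _. N)\<rparr>"

context
  fixes k :: "('k, 'r) ring_scheme" and P :: "('k, 'p) bialg" and N
  assumes P: "module k P" and N: "submodule N k P"
begin

interpretation module k P by (rule P)

lemma abelian_subgroup_submodule: "abelian_subgroup N P"
  using N submodule.axioms(1) abelian_group_axioms
  by (intro abelian_subgroupI3 additive_subgroup.intro) auto

interpretation N: abelian_subgroup N P by (rule abelian_subgroup_submodule)

text \<open>Writes elements of the quotient through representatives, so that later computations take
  place in \<open>P\<close>.\<close>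

lemma null_quotient_simps:
  shows "carrier (null_quotient P N) = (\<lambda>x. N +>\<^bsub>P\<^esub> x) ` carrier P"
    and "\<zero>\<^bsub>null_quotient P N\<^esub> = N"
    and "\<lbrakk>x \<in> carrier P; y \<in> carrier P\<rbrakk> \<Longrightarrow>
      (N +>\<^bsub>P\<^esub> x) \<oplus>\<^bsub>null_quotient P N\<^esub> (N +>\<^bsub>P\<^esub> y) = N +>\<^bsub>P\<^esub> (x \<oplus>\<^bsub>P\<^esub> y)"
    and "X \<otimes>\<^bsub>null_quotient P N\<^esub> Y = N"
    and "X \<star>\<^bsub>null_quotient P N\<^esub> Y = N"
  by (auto simp: null_quotient_def A_RCOSETS_def' N.a_rcos_sum)

lemma coset_eq_iff:
  assumes "x \<in> carrier P"
  shows "N +>\<^bsub>P\<^esub> x = N \<longleftrightarrow> x \<in> N"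
  using assms M.a_coset_join1 M.a_coset_join2 N.a_subgroup by blast

text \<open>Scaling a coset elementwise need not give a coset: the scalar zero collapses it to a
  single point. Adding \<open>N\<close> afterwards repairs this, since N + a(N + x) = (N + aN) + ax
  and N + aN = N.\<close>

lemma smult_null_quotient:
  assumes a: "a \<in> carrier k" and x: "x \<in> carrier P"
  shows "a \<odot>\<^bsub>null_quotient P N\<^esub> (N +>\<^bsub>P\<^esub> x) = N +>\<^bsub>P\<^esub> (a \<odot>\<^bsub>P\<^esub> x)"
proof -
  note sub = subsetD[OF submoduleE(1)[OF N]]
  have step: "n \<oplus>\<^bsub>P\<^esub> a \<odot>\<^bsub>P\<^esub> (m \<oplus>\<^bsub>P\<^esub> x) = (n \<oplus>\<^bsub>P\<^esub> a \<odot>\<^bsub>P\<^esub> m) \<oplus>\<^bsub>P\<^esub> a \<odot>\<^bsub>P\<^esub> x"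
    if "n \<in> N" "m \<in> N" for n m
    using a x that by (simp add: sub smult_r_distr M.a_assoc)
  have mem: "n \<oplus>\<^bsub>P\<^esub> a \<odot>\<^bsub>P\<^esub> m \<in> N" if "n \<in> N" "m \<in> N" for n m
    by (intro submoduleE(5)[OF N] submoduleE(4)[OF N] that a)
  have "a \<odot>\<^bsub>null_quotient P N\<^esub> (N +>\<^bsub>P\<^esub> x) = (\<Union>n\<in>N. \<Union>m\<in>N. {n \<oplus>\<^bsub>P\<^esub> a \<odot>\<^bsub>P\<^esub> (m \<oplus>\<^bsub>P\<^esub> x)})"
    by (simp add: null_quotient_def set_add_def' a_r_coset_def')
  also have "\<dots> = (\<Union>n\<in>N. \<Union>m\<in>N. {(n \<oplus>\<^bsub>P\<^esub> a \<odot>\<^bsub>P\<^esub> m) \<oplus>\<^bsub>P\<^esub> a \<odot>\<^bsub>P\<^esub> x})"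
    by (simp add: step cong: SUP_cong)
  \<comment> \<open>This is N + aN = N: closure of \<open>N\<close> gives one inclusion, the choice
    m = 0 the other.\<close>
  also have "\<dots> = (\<Union>n\<in>N. {n \<oplus>\<^bsub>P\<^esub> a \<odot>\<^bsub>P\<^esub> x})"
  proof
    show "(\<Union>n\<in>N. \<Union>m\<in>N. {(n \<oplus>\<^bsub>P\<^esub> a \<odot>\<^bsub>P\<^esub> m) \<oplus>\<^bsub>P\<^esub> a \<odot>\<^bsub>P\<^esub> x}) \<subseteq> (\<Union>n\<in>N. {n \<oplus>\<^bsub>P\<^esub> a \<odot>\<^bsub>P\<^esub> x})"
      using mem by blast
    show "(\<Union>n\<in>N. {n \<oplus>\<^bsub>P\<^esub> a \<odot>\<^bsub>P\<^esub> x}) \<subseteq> (\<Union>n\<in>N. \<Union>m\<in>N. {(n \<oplus>\<^bsub>P\<^esub> a \<odot>\<^bsub>P\<^esub> m) \<oplus>\<^bsub>P\<^esub> a \<odot>\<^bsub>P\<^esub> x})"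
      using a sub zero_mem_submodule[OF N]
      by (fastforce intro: bexI[of _ "\<zero>\<^bsub>P\<^esub>"])
  qed
  finally show ?thesis by (simp add: a_r_coset_def')
qed

lemma module_null_quotient: "module k (null_quotient P N)"
proof -
  let ?Q = "null_quotient P N"
  note qs = null_quotient_simps smult_null_quotient
  \<comment> \<open>The zero of the quotient is stored as \<open>N\<close>; as the coset of a
    representative it fits the rules for sums of cosets.\<close>
  have zero: "\<zero>\<^bsub>?Q\<^esub> = N +>\<^bsub>P\<^esub> \<zero>\<^bsub>P\<^esub>"
    using submoduleE(1)[OF N] by (simp add: qs)
  have "abelian_group ?Q"
  proof (rule abelian_groupI)
    fix X assume "X \<in> carrier ?Q"
    then obtain x where x: "x \<in> carrier P" "X = N +>\<^bsub>P\<^esub> x" by (auto simp: qs)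
    then show "\<exists>Y\<in>carrier ?Q. Y \<oplus>\<^bsub>?Q\<^esub> X = \<zero>\<^bsub>?Q\<^esub>"
      unfolding zero by (intro bexI[of _ "N +>\<^bsub>P\<^esub> (\<ominus>\<^bsub>P\<^esub> x)"]) (auto simp: qs M.l_neg)
    show "\<zero>\<^bsub>?Q\<^esub> \<oplus>\<^bsub>?Q\<^esub> X = X"
      unfolding zero using x by (simp add: qs)
  next
    show "\<zero>\<^bsub>?Q\<^esub> \<in> carrier ?Q" unfolding zero by (simp add: qs)
  qed (auto simp: qs M.a_ac)
  then show ?thesis
  proof (rule moduleI[OF R.is_cring])
    fix a b X assume ab: "a \<in> carrier k" "b \<in> carrier k" and "X \<in> carrier ?Q"
    then obtain x where x: "x \<in> carrier P" "X = N +>\<^bsub>P\<^esub> x" by (auto simp: qs)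
    show "(a \<oplus>\<^bsub>k\<^esub> b) \<odot>\<^bsub>?Q\<^esub> X = (a \<odot>\<^bsub>?Q\<^esub> X) \<oplus>\<^bsub>?Q\<^esub> (b \<odot>\<^bsub>?Q\<^esub> X)"
      using ab x by (simp add: qs smult_l_distr)
    show "(a \<otimes>\<^bsub>k\<^esub> b) \<odot>\<^bsub>?Q\<^esub> X = a \<odot>\<^bsub>?Q\<^esub> (b \<odot>\<^bsub>?Q\<^esub> X)"
      using ab x by (simp add: qs smult_assoc1)
  next
    fix a X Y assume a: "a \<in> carrier k" and "X \<in> carrier ?Q" "Y \<in> carrier ?Q"
    then obtain x y where "x \<in> carrier P" "X = N +>\<^bsub>P\<^esub> x" "y \<in> carrier P" "Y = N +>\<^bsub>P\<^esub> y"
      by (auto simp: qs)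
    then show "a \<odot>\<^bsub>?Q\<^esub> (X \<oplus>\<^bsub>?Q\<^esub> Y) = (a \<odot>\<^bsub>?Q\<^esub> X) \<oplus>\<^bsub>?Q\<^esub> (a \<odot>\<^bsub>?Q\<^esub> Y)"
      using a by (simp add: qs smult_r_distr)
  qed (auto simp: qs)
qed

end

section \<open>The derived algebra of a transposed Novikov-Poisson algebra\<close>

context transposed_novikov_poisson
begin

lemma products_closed:
  "\<lbrakk>x \<in> carrier P; y \<in> carrier P\<rbrakk> \<Longrightarrow> x \<otimes>\<^bsub>P\<^esub> y \<in> carrier P"
  "\<lbrakk>x \<in> carrier P; y \<in> carrier P\<rbrakk> \<Longrightarrow> x \<star>\<^bsub>P\<^esub> y \<in> carrier P"
  using mult_bilinear circ_bilinear by (auto simp: bilinear_op_def)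

lemma submodule_derived:
  assumes "A \<subseteq> carrier P"
  shows "submodule (derived_bialg k P A) k P"
  unfolding derived_bialg_def
  using assms
  by (intro submodule_set_add submodule_span_prod mult_bilinear circ_bilinear module_axioms)

lemma products_mem_derived:
  assumes "A \<subseteq> carrier P" "x \<in> A" "y \<in> A"
  shows "x \<otimes>\<^bsub>P\<^esub> y \<in> derived_bialg k P A" "x \<star>\<^bsub>P\<^esub> y \<in> derived_bialg k P A"
proof -
  let ?S = "\<lambda>f. span_prod k P f A A"
  have mem: "x \<otimes>\<^bsub>P\<^esub> y \<in> ?S (monoid.mult P)" "x \<star>\<^bsub>P\<^esub> y \<in> ?S (circ P)"
    by (rule span_prod_mem[OF assms(2,3)])+
  \<comment> \<open>The derived algebra is a sum of two spans, so a product from one of them is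
    paired with the zero of the other.\<close>
  have "\<zero>\<^bsub>P\<^esub> \<in> ?S (monoid.mult P)" "\<zero>\<^bsub>P\<^esub> \<in> ?S (circ P)"
    using assms(1) zero_mem_submodule submodule_span_prod[OF module_axioms]
      mult_bilinear circ_bilinear by blast+
  then have "x \<otimes>\<^bsub>P\<^esub> y \<oplus>\<^bsub>P\<^esub> \<zero>\<^bsub>P\<^esub> \<in> derived_bialg k P A" "\<zero>\<^bsub>P\<^esub> \<oplus>\<^bsub>P\<^esub> x \<star>\<^bsub>P\<^esub> y \<in> derived_bialg k P A"
    using mem unfolding derived_bialg_def set_add_def' by blast+
  then show "x \<otimes>\<^bsub>P\<^esub> y \<in> derived_bialg k P A" "x \<star>\<^bsub>P\<^esub> y \<in> derived_bialg k P A"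
    using assms products_closed by (simp_all add: subset_iff)
qed

lemma derived_subset_carrier: "derived_bialg k P (carrier P) \<subseteq> carrier P"
  by (rule submoduleE(1)[OF submodule_derived[OF subset_refl]])

text \<open>Since P^2 lies in P, monotonicity puts the derived algebra of P^2 inside P^2.\<close>

lemma subalgebra_derived: "subalgebra_bialg k P (derived_bialg k P (carrier P))"
  unfolding subalgebra_bialg_def
  by (intro conjI submodule_derived derived_bialg_mono derived_subset_carrier subset_refl)

text \<open>Bilinearity carries the vanishing from generators to the span in one argument at a time,
  using a left and then a right annihilator.\<close>

lemma abelian_on_derived:
  assumes "\<And>m1 m2 m3 c1 c2 c3 c4.
      \<lbrakk>m1 \<in> {monoid.mult P, circ P}; m2 \<in> {monoid.mult P, circ P}; m3 \<in> {monoid.mult P, circ P};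
       c1 \<in> carrier P; c2 \<in> carrier P; c3 \<in> carrier P; c4 \<in> carrier P\<rbrakk> \<Longrightarrow>
      m2 (m1 c1 c2) (m3 c3 c4) = \<zero>\<^bsub>P\<^esub>"
  shows "abelian_on P (derived_bialg k P (carrier P))"
proof -
  let ?D = "derived_bialg k P (carrier P)"
  let ?T = "{m x y | m x y. m \<in> {monoid.mult P, circ P} \<and> x \<in> carrier P \<and> y \<in> carrier P}"
  have T: "?T \<subseteq> carrier P" using products_closed by auto
  \<comment> \<open>An induction principle for \<open>?D\<close>: a property that cuts out a
    submodule and holds for every product of two elements holds on all of \<open>?D\<close>.\<close>
  have ind: "?D \<subseteq> {x \<in> carrier P. Q x}"
    if "submodule {x \<in> carrier P. Q x} k P" "\<And>t. t \<in> ?T \<Longrightarrow> Q t" for Q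
    by (rule derived_bialg_subset[OF module_axioms that(1)])
      (auto intro!: that(2) products_closed)
  have zero: "f x y = \<zero>\<^bsub>P\<^esub>" if f: "f \<in> {monoid.mult P, circ P}" and xy: "x \<in> ?D" "y \<in> ?D" for f x y
  proof -
    have bil: "bilinear_op k P f" using f mult_bilinear circ_bilinear by auto
    have TT: "f u v = \<zero>\<^bsub>P\<^esub>" if uv: "u \<in> ?T" "v \<in> ?T" for u v
    proof -
      obtain m c d m' c' d' where
        "m \<in> {monoid.mult P, circ P}" "c \<in> carrier P" "d \<in> carrier P" "u = m c d"
        "m' \<in> {monoid.mult P, circ P}" "c' \<in> carrier P" "d' \<in> carrier P" "v = m' c' d'"
        using uv by blast
      then show ?thesis using assms[OF _ f] by simp
    qed
    \<comment> \<open>The first argument is extended to \<open>?D\<close> while the second stays a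
      single product.\<close>
    have "?D \<subseteq> {u \<in> carrier P. \<forall>v\<in>?T. f u v = \<zero>\<^bsub>P\<^esub>}"
      by (rule ind[OF submodule_left_annihilator[OF module_axioms bil T]]) (intro ballI TT)
    then have DT: "f u v = \<zero>\<^bsub>P\<^esub>" if "u \<in> ?D" "v \<in> ?T" for u v using that by blast
    \<comment> \<open>Now the right annihilator of all of \<open>?D\<close> contains the products in
      \<open>?T\<close>, hence \<open>?D\<close> itself.\<close>
    have "?D \<subseteq> {v \<in> carrier P. \<forall>u\<in>?D. f u v = \<zero>\<^bsub>P\<^esub>}"
      by (rule ind[OF submodule_right_annihilator[OF module_axioms bil derived_subset_carrier]])
        (intro ballI DT)
    then show ?thesis using xy by blast
  qed
  show ?thesis unfolding abelian_on_def by (intro ballI conjI zero) auto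
qed

lemma abelian_derived_imp_solvable:
  assumes "abelian_on P (derived_bialg k P (carrier P))"
  shows "solvable_bialg k P"
proof -
  let ?D = "derived_bialg k P (carrier P)"
  have "\<zero>\<^bsub>P\<^esub> \<in> derived_bialg k P ?D"
    by (intro zero_mem_submodule submodule_derived derived_subset_carrier)
  moreover have "derived_bialg k P ?D \<subseteq> {\<zero>\<^bsub>P\<^esub>}"
    using assms by (intro derived_bialg_subset module_axioms submodule_zero) (auto simp: abelian_on_def)
  \<comment> \<open>Index 0 is P and index 1 is \<open>?D\<close>, so index 2 is the derived algebra
    of \<open>?D\<close>.\<close>
  ultimately have "derived_series_bialg k P 2 = {\<zero>\<^bsub>P\<^esub>}"
    by (auto simp: derived_series_bialg_def numeral_2_eq_2)
  then show ?thesis unfolding solvable_bialg_def by blast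
qed

section \<open>Metatriviality against abelianness of the derived algebra\<close>

lemma metatrivial_imp_abelian_derived:
  assumes "metatrivial k P"
  shows "abelian_on P (derived_bialg k P (carrier P))"
proof -
  obtain V1 :: "('k, 'p) bialg" and V2 :: "('k, 'p set) bialg" and i p
    where V1: "abelian_tnp k V1" and V2: "abelian_tnp k V2" and ex: "short_exact k V1 i P p V2"
    using assms unfolding metatrivial_def by blast
  interpret V1: transposed_novikov_poisson k V1 using V1 by (simp add: abelian_tnp_def)
  interpret V2: transposed_novikov_poisson k V2 using V2 by (simp add: abelian_tnp_def)
  have i: "i \<in> bialg_hom k V1 P" and p: "p \<in> bialg_hom k P V2"
    and ker: "a_kernel V1 P i = {\<zero>\<^bsub>V1\<^esub>}" and mid: "i ` carrier V1 = a_kernel P V2 p"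
    using ex by (auto simp: short_exact_def)
  let ?K = "a_kernel P V2 p"
  have pc: "p x \<in> carrier V2" if "x \<in> carrier P" for x using p that by (auto simp: bialg_hom_def)
  \<comment> \<open>\<open>bialg_hom\<close> does not state that zero is preserved; homogeneity with
    the scalar zero gives it.\<close>
  have p0: "p \<zero>\<^bsub>P\<^esub> = \<zero>\<^bsub>V2\<^esub>"
  proof -
    have "p (\<zero>\<^bsub>k\<^esub> \<odot>\<^bsub>P\<^esub> \<zero>\<^bsub>P\<^esub>) = \<zero>\<^bsub>k\<^esub> \<odot>\<^bsub>V2\<^esub> p \<zero>\<^bsub>P\<^esub>"
      using p zero_closed M.zero_closed unfolding bialg_hom_def by blast
    then show ?thesis using pc by simp
  qed
  have i0: "i \<zero>\<^bsub>V1\<^esub> = \<zero>\<^bsub>P\<^esub>" using ker by (auto simp: a_kernel_def')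
  have K: "submodule ?K k P"
    using p p0 by (intro submoduleI_smult) (auto simp: a_kernel_def' bialg_hom_def)
  \<comment> \<open>\<open>p\<close> turns each product in P into a product in the abelian
    \<open>V2\<close>, so every product lies in the kernel.\<close>
  have "derived_bialg k P (carrier P) \<subseteq> ?K"
    using p pc V2 products_closed
    by (intro derived_bialg_subset module_axioms K)
      (auto simp: a_kernel_def' bialg_hom_def abelian_tnp_def abelian_on_def)
  \<comment> \<open>By exactness \<open>?K\<close> is the image of \<open>V1\<close>, so its
    products are images of products that vanish.\<close>
  moreover have "abelian_on P ?K"
    unfolding mid[symmetric] abelian_on_def
  proof (intro ballI)
    fix a b assume "a \<in> i ` carrier V1" "b \<in> i ` carrier V1"
    then obtain u v where *: "u \<in> carrier V1" "v \<in> carrier V1" "a = i u" "b = i v" by auto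
    then have "a \<otimes>\<^bsub>P\<^esub> b = i (u \<otimes>\<^bsub>V1\<^esub> v)" "a \<star>\<^bsub>P\<^esub> b = i (u \<star>\<^bsub>V1\<^esub> v)"
      using i by (auto simp: bialg_hom_def)
    then show "a \<otimes>\<^bsub>P\<^esub> b = \<zero>\<^bsub>P\<^esub> \<and> a \<star>\<^bsub>P\<^esub> b = \<zero>\<^bsub>P\<^esub>"
      using * V1 i0 by (simp add: abelian_tnp_def abelian_on_def)
  qed
  ultimately show ?thesis by (auto simp: abelian_on_def subset_iff)
qed

lemma abelian_derived_imp_metatrivial:
  assumes ab: "abelian_on P (derived_bialg k P (carrier P))"
  shows "metatrivial k P"
proof -
  let ?D = "derived_bialg k P (carrier P)"
  let ?V = "P\<lparr>carrier := ?D\<rparr>" and ?Q = "null_quotient P ?D" and ?p = "\<lambda>x. ?D +>\<^bsub>P\<^esub> x"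
  have D: "submodule ?D k P" by (rule submodule_derived) simp
  note sub = subsetD[OF submoduleE(1)[OF D]]
  note qs = null_quotient_simps[OF module_axioms D] smult_null_quotient[OF module_axioms D]
  note coset = coset_eq_iff[OF module_axioms D]
  have V: "abelian_tnp k ?V"
    using ab by (intro abelian_tnpI field_axioms submodule.submodule_is_module[OF D] module_axioms)
      (simp add: abelian_on_def)
  have Q: "abelian_tnp k ?Q"
    by (intro abelian_tnpI field_axioms module_null_quotient[OF module_axioms D])
      (simp add: abelian_on_def qs)
  have "id \<in> bialg_hom k ?V P"
    using sub by (auto simp: bialg_hom_def)
  \<comment> \<open>Products lie in \<open>?D\<close>, so their coset is \<open>?D\<close>, which is
    the constant value of both products of \<open>?Q\<close>.\<close>
  moreover have "?p \<in> bialg_hom k P ?Q"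
    using products_mem_derived[of "carrier P"] products_closed
    by (auto simp: bialg_hom_def qs coset)
  moreover have "a_kernel ?V P id = {\<zero>\<^bsub>?V\<^esub>}"
    using zero_mem_submodule[OF D] by (auto simp: a_kernel_def')
  moreover have "id ` carrier ?V = a_kernel P ?Q ?p"
  proof -
    \<comment> \<open>The coset of x is the zero \<open>?D\<close> of \<open>?Q\<close> exactly when
      x lies in \<open>?D\<close>.\<close>
    have "a_kernel P ?Q ?p = {x \<in> carrier P. x \<in> ?D}"
      by (simp add: a_kernel_def' qs coset cong: conj_cong)
    then show ?thesis using sub by auto
  qed
  moreover have "?p ` carrier P = carrier ?Q" by (simp add: qs)
  ultimately have "short_exact k ?V id P ?p ?Q" by (simp add: short_exact_def)
  then show ?thesis unfolding metatrivial_def using V Q by blast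
qed

end

theorem proposition4p2:
  fixes k :: "('k, 'r) ring_scheme" and P :: "('k, 'p) bialg"
  assumes "transposed_novikov_poisson k P"
    and "ring_char k \<noteq> 2"
  shows "(metatrivial k P \<longleftrightarrow>
           solvable_bialg k P \<and>
           (\<forall>m1\<in>{monoid.mult P, circ P}. \<forall>m2\<in>{monoid.mult P, circ P}. \<forall>m3\<in>{monoid.mult P, circ P}.
              \<forall>c1\<in>carrier P. \<forall>c2\<in>carrier P. \<forall>c3\<in>carrier P. \<forall>c4\<in>carrier P.
                m2 (m1 c1 c2) (m3 c3 c4) = \<zero>\<^bsub>P\<^esub>)) \<and>
         (metatrivial k P \<longleftrightarrow>
           subalgebra_bialg k P (derived_bialg k P (carrier P)) \<and>
           abelian_on P (derived_bialg k P (carrier P)))"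
    (is "(_ \<longleftrightarrow> _ \<and> ?b) \<and> _")
proof -
  interpret transposed_novikov_poisson k P by (rule assms)
  let ?D = "derived_bialg k P (carrier P)"
  \<comment> \<open>Abelianness of \<open>?D\<close> is the hub: each of the three conditions is
    shown equivalent to it.\<close>
  have meta: "metatrivial k P \<longleftrightarrow> abelian_on P ?D"
    using metatrivial_imp_abelian_derived abelian_derived_imp_metatrivial by blast
  have "?b" if "abelian_on P ?D"
    using that products_mem_derived[of "carrier P"] by (auto simp: abelian_on_def)
  moreover have "abelian_on P ?D" if ?b
    using that by (intro abelian_on_derived) blast
  ultimately show ?thesis
    using meta abelian_derived_imp_solvable subalgebra_derived by blast
qed

end
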